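(* Let $S\subseteq\mathbb{Z}_2^n$ be a Sidon set with $0\notin S$ that generates $\mathbb{Z}_2^n$, and suppose that $Q_S$ admits a unitary signing. Then $Q_S$ admits an orthogonal signing if and only if it has no $S$-simple closed walk whose length is congruent to $2$ or $3$ modulo $4$.
   Context: For $S\subseteq\mathbb{Z}_2^n$ with $0\notin S$, $Q_S$ is the (loopless, simple) graph with vertex set $\mathbb{Z}_2^n$ in which $x,y$ are adjacent iff $x+y\in S$; the element $x+y\in S$ is the label of the edge $xy$. $S$ is a Sidon set if for all $a,b,c,d\in S$ with $a\ne b$, $c\neq d$ and $a+b=c+d$ one has $\{a,b\}=\{c,d\}$. A closed walk $W$ in $Q_S$ is $S$-simple if each element of $S$ is the label of at most one edge (step) of $W$. A complex signing of a graph $G$ assigns to each ordered pair $(x,y)$ of adjacent vertices a value $\sigma(xy)\in\{1,-1,i,-i\}$ such that $\sigma(yx)=\overline{\sigma(xy)}$. Its adjacency matrix $M$ ($M_{xy}=\sigma(xy)$ for adjacent $x,y$, and $0$ otherwise) is Hermitian. For a $d$-regular graph the signing is unitary if $M^2=dI$; a unitary signing is orthogonal if all its values lie in $\{1,-1\}$. *)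

theory Defs
  imports
    Complex_Main
    "HOL-Library.Z2"
    "HOL-Library.Function_Algebras"
    "HOL-Computational_Algebra.Group_Closure"
    "Graph_Theory.Pair_Digraph"
begin

text \<open>
  The group \<open>\<int>\<^sub>2\<^sup>n\<close> is the set of bit sequences supported on \<open>{0..<n}\<close>, with the
  pointwise addition of the type \<^typ>\<open>nat \<Rightarrow> bit\<close>. In this way \<open>n\<close> is an arbitrary natural
  number (\<open>n = 0\<close> included).
\<close>

definition Z2n :: "nat \<Rightarrow> (nat \<Rightarrow> bit) set" where
  "Z2n n = {x. \<forall>i\<ge>n. x i = 0}"

definition sidon :: "'a::plus set \<Rightarrow> bool" where
  "sidon S \<longleftrightarrow> (\<forall>a\<in>S. \<forall>b\<in>S. \<forall>c\<in>S. \<forall>d\<in>S.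
     a \<noteq> b \<longrightarrow> c \<noteq> d \<longrightarrow> a + b = c + d \<longrightarrow> {a, b} = {c, d})"

text \<open>
  Graphs are symmetric digraphs without parallel arcs: an edge \<open>xy\<close> is the pair of arcs
  \<open>(x, y)\<close> and \<open>(y, x)\<close>, so the ordered pairs of adjacent vertices are the arcs.
\<close>

definition QS :: "nat \<Rightarrow> (nat \<Rightarrow> bit) set \<Rightarrow> (nat \<Rightarrow> bit) pair_pre_digraph" where
  "QS n S = \<lparr> pverts = Z2n n, parcs = {(x, y). x \<in> Z2n n \<and> y \<in> Z2n n \<and> x + y \<in> S} \<rparr>"

definition edge_label :: "(nat \<Rightarrow> bit) \<times> (nat \<Rightarrow> bit) \<Rightarrow> (nat \<Rightarrow> bit)" where
  "edge_label e = fst e + snd e"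

text \<open>
  A walk is the list of its arcs, so its length is the number of steps. Repeated traversals of
  the same edge count as different steps: going back and forth along one edge is not simple.
\<close>

definition S_simple_closed_walk ::
  "nat \<Rightarrow> (nat \<Rightarrow> bit) set \<Rightarrow> ((nat \<Rightarrow> bit) \<times> (nat \<Rightarrow> bit)) list \<Rightarrow> bool" where
  "S_simple_closed_walk n S p \<longleftrightarrow>
     (\<exists>u. pre_digraph.awalk (with_proj (QS n S)) u p u) \<and> distinct (map edge_label p)"

definition complex_signing :: "'v pair_pre_digraph \<Rightarrow> ('v \<Rightarrow> 'v \<Rightarrow> complex) \<Rightarrow> bool" where
  "complex_signing G \<sigma> \<longleftrightarrow>
     (\<forall>(x, y)\<in>parcs G. \<sigma> x y \<in> {1, -1, \<i>, -\<i>} \<and> \<sigma> y x = cnj (\<sigma> x y))"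

definition adj_matrix ::
  "'v pair_pre_digraph \<Rightarrow> ('v \<Rightarrow> 'v \<Rightarrow> complex) \<Rightarrow> 'v \<Rightarrow> 'v \<Rightarrow> complex" where
  "adj_matrix G \<sigma> x y = (if (x, y) \<in> parcs G then \<sigma> x y else 0)"

definition regular_graph :: "'v pair_pre_digraph \<Rightarrow> nat \<Rightarrow> bool" where
  "regular_graph G d \<longleftrightarrow> (\<forall>v\<in>pverts G. out_degree (with_proj G) v = d)"

text \<open>The second conjunct of the body is the identity \<open>M\<^sup>2 = d I\<close>, written entrywise.\<close>

definition unitary_signing :: "'v pair_pre_digraph \<Rightarrow> ('v \<Rightarrow> 'v \<Rightarrow> complex) \<Rightarrow> bool" where
  "unitary_signing G \<sigma> \<longleftrightarrow> complex_signing G \<sigma> \<and>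
     (\<exists>d. regular_graph G d \<and>
        (\<forall>x\<in>pverts G. \<forall>y\<in>pverts G.
           (\<Sum>z\<in>pverts G. adj_matrix G \<sigma> x z * adj_matrix G \<sigma> z y) =
           (if x = y then of_nat d else 0)))"

definition orthogonal_signing :: "'v pair_pre_digraph \<Rightarrow> ('v \<Rightarrow> 'v \<Rightarrow> complex) \<Rightarrow> bool" where
  "orthogonal_signing G \<sigma> \<longleftrightarrow>
     unitary_signing G \<sigma> \<and> (\<forall>(x, y)\<in>parcs G. \<sigma> x y \<in> {1, -1})"

lemma finite_Z2n: "finite (Z2n n)"
proof (rule finite_subset)
  show "Z2n n \<subseteq> {f. \<forall>i. (i \<in> {..<n} \<longrightarrow> f i \<in> UNIV) \<and> (i \<notin> {..<n} \<longrightarrow> f i = 0)}"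
    by (auto simp: Z2n_def)
  have "(UNIV :: bit set) = {0, 1}"
    by (auto intro: bit.exhaust)
  then have "finite (UNIV :: bit set)"
    by (metis finite.emptyI finite.insertI)
  then show "finite {f :: nat \<Rightarrow> bit. \<forall>i. (i \<in> {..<n} \<longrightarrow> f i \<in> UNIV) \<and> (i \<notin> {..<n} \<longrightarrow> f i = 0)}"
    by (intro finite_set_of_finite_funs) auto
qed

lemma bit_fun_add_self: "x + x = (0 :: nat \<Rightarrow> bit)"
  by (rule ext) (simp add: plus_fun_def)

lemma pair_graph_QS:
  assumes "0 \<notin> S"
  shows "pair_graph (QS n S)"
proof
  show "finite (pverts (QS n S))"
    by (simp add: QS_def finite_Z2n)
  show "finite (parcs (QS n S))"
    by (rule finite_subset[of _ "Z2n n \<times> Z2n n"]) (auto simp: QS_def finite_Z2n)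
  show "symmetric (with_proj (QS n S))"
    by (auto simp: symmetric_def sym_def QS_def add.commute)
qed (use assms in \<open>auto simp: QS_def bit_fun_add_self\<close>)

lemma regular_QS:
  assumes "S \<subseteq> Z2n n"
  shows "regular_graph (QS n S) (card S)"
  unfolding regular_graph_def
proof
  fix v assume "v \<in> pverts (QS n S)"
  then have v: "v \<in> Z2n n" by (simp add: QS_def)
  have cancel: "v + (v + s) = s" for s
    by (simp add: add.assoc[symmetric] bit_fun_add_self)
  have mem: "v + s \<in> Z2n n" if "s \<in> S" for s
    using v that assms by (auto simp: Z2n_def)
  have "out_arcs (with_proj (QS n S)) v = (\<lambda>s. (v, v + s)) ` S"
  proof
    show "out_arcs (with_proj (QS n S)) v \<subseteq> (\<lambda>s. (v, v + s)) ` S"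
    proof
      fix e assume "e \<in> out_arcs (with_proj (QS n S)) v"
      then obtain y where e: "e = (v, y)" "v + y \<in> S"
        by (cases e) (auto simp: out_arcs_def QS_def)
      then have "e = (v, v + (v + y))" by (simp add: cancel)
      with e(2) show "e \<in> (\<lambda>s. (v, v + s)) ` S" by blast
    qed
    show "(\<lambda>s. (v, v + s)) ` S \<subseteq> out_arcs (with_proj (QS n S)) v"
      using v mem by (auto simp: out_arcs_def QS_def cancel)
  qed
  moreover have "inj_on (\<lambda>s. (v, v + s)) S"
    by (auto intro!: inj_onI)
  ultimately show "out_degree (with_proj (QS n S)) v = card S"
    by (simp add: out_degree_def card_image)
qed

end

theory Submission
  imports Defs
begin

text \<open>
  The gain of a walk is the product of the signing values along it. Since \<open>S\<close> is Sidon, two vertices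
  at distance two have exactly two common neighbours, so the off-diagonal part of \<open>M\<^sup>2 = d I\<close> says
  that swapping two consecutive distinct labels of a walk negates its gain. Reversing the labels of
  an \<open>S\<close>-simple closed walk of length \<open>k\<close> conjugates the gain, but it also multiplies it by
  \<open>(-1) ^ (k choose 2)\<close>; hence the gain is real iff \<open>k mod 4 \<in> {0, 1}\<close>. If only such lengths
  occur, every closed walk has real gain, because swaps and cancellations of equal consecutive labels
  turn it into an \<open>S\<close>-simple one, and switching by the gains of walks from \<open>0\<close> makes the
  signing real.
\<close>

section \<open>Arithmetic of \<int> modulo 2 vectors and generation by sums\<close>

lemma bit_fun_add_cancel [simp]: "(x :: nat \<Rightarrow> bit) + (x + y) = y"
  by (simp add: add.assoc[symmetric] bit_fun_add_self)

lemma bit_fun_minus: "- x = (x :: nat \<Rightarrow> bit)"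
  by (metis add_eq_0_iff bit_fun_add_self)

lemma bit_fun_add_eq_0_iff: "x + y = 0 \<longleftrightarrow> x = (y :: nat \<Rightarrow> bit)"
  by (metis add_eq_0_iff bit_fun_minus)

lemma Z2n_add: "x \<in> Z2n n \<Longrightarrow> y \<in> Z2n n \<Longrightarrow> x + y \<in> Z2n n"
  by (auto simp: Z2n_def)

lemma Z2n_0: "0 \<in> Z2n n"
  by (auto simp: Z2n_def)

lemma pverts_QS [simp]: "pverts (QS n S) = Z2n n"
  by (simp add: QS_def)

lemma parcs_QS_iff [simp]:
  "(x, y) \<in> parcs (QS n S) \<longleftrightarrow> x \<in> Z2n n \<and> y \<in> Z2n n \<and> x + y \<in> S"
  by (simp add: QS_def)

text \<open>Coordinates no longer matter; the rule would fire on eta-expanded sums.\<close>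

declare plus_fun_apply [simp del]

lemma Z2n_add_sum_list: "x \<in> Z2n n \<Longrightarrow> set l \<subseteq> Z2n n \<Longrightarrow> x + sum_list l \<in> Z2n n"
  by (induction l arbitrary: x) (auto simp: Z2n_add add.assoc[symmetric])

text \<open>Negation is the identity here, so a difference of two sums is again a sum: the lists are
  concatenated.\<close>

lemma group_closure_sum_list:
  assumes "x \<in> group_closure (S :: (nat \<Rightarrow> bit) set)"
  shows "\<exists>l. set l \<subseteq> S \<and> sum_list l = x"
  using assms
proof induction
  case (base s)
  show ?case
  proof (cases "s \<in> S")
    case True
    then show ?thesis by (intro exI[of _ "[s]"]) simp
  next
    \<comment> \<open>The base rule of \<open>group_closure\<close> also admits 0, which is the
      empty sum.\<close>
    case False
    then show ?thesis using base by (intro exI[of _ "[]"]) simp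
  qed
next
  case (diff s t)
  then obtain l m where "set l \<subseteq> S" "sum_list l = s" "set m \<subseteq> S" "sum_list m = t" by blast
  then show ?case
    by (intro exI[of _ "l @ m"]) (simp add: diff_conv_add_uminus bit_fun_minus del: add_uminus_conv_diff)
qed

section \<open>Walks as label lists, and their gains\<close>

text \<open>A walk in \<open>QS n S\<close> is determined by its start and its labels. Encoding it
  this way turns swapping, cancelling and reversing of steps into list operations.\<close>

fun label_walk :: "'a::plus \<Rightarrow> 'a list \<Rightarrow> ('a \<times> 'a) list" where
  "label_walk x [] = []"
| "label_walk x (s # l) = (x, x + s) # label_walk (x + s) l"

lemma length_label_walk [simp]: "length (label_walk x l) = length l"
  by (induction l arbitrary: x) auto

lemma map_edge_label_label_walk [simp]: "map edge_label (label_walk x l) = l"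
  by (induction l arbitrary: x) (auto simp: edge_label_def)

fun gain :: "('a::plus \<Rightarrow> 'a \<Rightarrow> complex) \<Rightarrow> 'a \<Rightarrow> 'a list \<Rightarrow> complex" where
  "gain \<sigma> x [] = 1"
| "gain \<sigma> x (s # l) = \<sigma> x (x + s) * gain \<sigma> (x + s) l"

lemma gain_append:
  "gain \<sigma> x (l @ m) = gain \<sigma> x l * gain \<sigma> (x + sum_list l) m" for x :: "'a::monoid_add"
  by (induction l arbitrary: x) (auto simp: add.assoc)

lemma awalk_label_walk:
  assumes "S \<subseteq> Z2n n" "0 \<notin> S" "set l \<subseteq> S" "x \<in> Z2n n"
  shows "pre_digraph.awalk (with_proj (QS n S)) x (label_walk x l) (x + sum_list l)"
proof -
  interpret pair_graph "QS n S" using assms(2) by (rule pair_graph_QS)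
  show ?thesis
    using assms(3,4)
  proof (induction l arbitrary: x)
    case (Cons s l)
    then have xs: "x + s \<in> Z2n n" using assms(1) by (auto intro: Z2n_add)
    have "awalk (x + s) (label_walk (x + s) l) (x + s + sum_list l)"
      using Cons.prems by (intro Cons.IH xs) auto
    with Cons.prems xs show ?case
      by (simp add: awalk_Cons_iff add.assoc)
  qed (simp add: awalk_Nil_iff)
qed

lemma awalk_edge_labels:
  assumes "0 \<notin> S" "pre_digraph.awalk (with_proj (QS n S)) u p v"
  shows "u \<in> Z2n n \<and> set (map edge_label p) \<subseteq> S \<and> v = u + sum_list (map edge_label p)"
proof -
  interpret pair_graph "QS n S" using assms(1) by (rule pair_graph_QS)
  show ?thesis
    using assms(2)
    by (induction p arbitrary: u)
      (auto simp: awalk_Nil_iff awalk_Cons_iff edge_label_def add.assoc)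
qed

text \<open>Translations preserve labels, so a closed walk may be moved to start at 0; only its
  label list matters.\<close>

lemma S_simple_closed_walk_iff:
  assumes "S \<subseteq> Z2n n" "0 \<notin> S"
  shows "(\<exists>p. S_simple_closed_walk n S p \<and> P (length p)) \<longleftrightarrow>
    (\<exists>l. set l \<subseteq> S \<and> distinct l \<and> sum_list l = 0 \<and> P (length l))"
proof
  assume "\<exists>p. S_simple_closed_walk n S p \<and> P (length p)"
  then obtain p u where p: "pre_digraph.awalk (with_proj (QS n S)) u p u"
    "distinct (map edge_label p)" "P (length p)"
    by (auto simp: S_simple_closed_walk_def)
  show "\<exists>l. set l \<subseteq> S \<and> distinct l \<and> sum_list l = 0 \<and> P (length l)"
    using awalk_edge_labels[OF assms(2) p(1)] p(2,3) by (intro exI[of _ "map edge_label p"]) simp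
next
  assume "\<exists>l. set l \<subseteq> S \<and> distinct l \<and> sum_list l = 0 \<and> P (length l)"
  then obtain l where l: "set l \<subseteq> S" "distinct l" "sum_list l = 0" "P (length l)" by blast
  then show "\<exists>p. S_simple_closed_walk n S p \<and> P (length p)"
    using awalk_label_walk[OF assms l(1) Z2n_0]
    by (intro exI[of _ "label_walk 0 l"]) (auto simp: S_simple_closed_walk_def)
qed

section \<open>Gains under a unitary signing\<close>

locale unitary_QS =
  fixes n :: nat and S :: "(nat \<Rightarrow> bit) set" and \<sigma> :: "(nat \<Rightarrow> bit) \<Rightarrow> (nat \<Rightarrow> bit) \<Rightarrow> complex"
  assumes S_subset: "S \<subseteq> Z2n n"
    and sidon: "sidon S"
    and unitary: "unitary_signing (QS n S) \<sigma>"
begin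

lemma signing_mem: "x \<in> Z2n n \<Longrightarrow> y \<in> Z2n n \<Longrightarrow> x + y \<in> S \<Longrightarrow> \<sigma> x y \<in> {1, -1, \<i>, -\<i>}"
  and signing_cnj: "x \<in> Z2n n \<Longrightarrow> y \<in> Z2n n \<Longrightarrow> x + y \<in> S \<Longrightarrow> \<sigma> y x = cnj (\<sigma> x y)"
  using unitary unfolding unitary_signing_def complex_signing_def by auto

lemma signing_mult_cnj:
  "x \<in> Z2n n \<Longrightarrow> y \<in> Z2n n \<Longrightarrow> x + y \<in> S \<Longrightarrow> \<sigma> x y * \<sigma> y x = 1"
  using signing_mem[of x y] signing_cnj[of x y] by auto

text \<open>The entry of the squared matrix at \<open>x\<close> and \<open>x + a + b\<close>
  vanishes, and only the paths through \<open>x + a\<close> and \<open>x + b\<close> contribute to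
  it.\<close>

lemma signing_square:
  assumes x: "x \<in> Z2n n" and a: "a \<in> S" and b: "b \<in> S" and ab: "a \<noteq> b"
  shows "\<sigma> x (x + a) * \<sigma> (x + a) (x + a + b) = - (\<sigma> x (x + b) * \<sigma> (x + b) (x + a + b))"
proof -
  let ?y = "x + a + b"
  have mem: "x + a \<in> Z2n n" "x + b \<in> Z2n n" "?y \<in> Z2n n"
    using x a b S_subset by (auto intro!: Z2n_add)
  have "x \<noteq> ?y"
    using ab bit_fun_add_eq_0_iff[of a b] by (simp add: add.assoc)
  then have 0: "(\<Sum>z\<in>Z2n n. adj_matrix (QS n S) \<sigma> x z * adj_matrix (QS n S) \<sigma> z ?y) = 0"
    using unitary x mem unfolding unitary_signing_def by auto
  \<comment> \<open>A common neighbour \<open>z\<close> writes \<open>a + b\<close> as a sum of two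
    labels. They differ because \<open>a + b\<close> is nonzero, so the Sidon property identifies
    them with \<open>a\<close> and \<open>b\<close>.\<close>
  have nz: "z \<in> {x + a, x + b}" if "x + z \<in> S" "z + ?y \<in> S" for z
  proof -
    have eq: "(x + z) + (z + ?y) = a + b"
      by (simp add: add.assoc add.left_commute[of z])
    then have "x + z \<noteq> z + ?y"
      using ab by (metis bit_fun_add_eq_0_iff)
    then have "{x + z, z + ?y} = {a, b}"
      using sidon that a b ab eq unfolding sidon_def by blast
    then have "x + z = a \<or> x + z = b" by blast
    then show ?thesis by (metis bit_fun_add_cancel insertCI)
  qed
  have "(\<Sum>z\<in>Z2n n. adj_matrix (QS n S) \<sigma> x z * adj_matrix (QS n S) \<sigma> z ?y)
      = (\<Sum>z\<in>{x + a, x + b}. adj_matrix (QS n S) \<sigma> x z * adj_matrix (QS n S) \<sigma> z ?y)"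
    using mem nz by (intro sum.mono_neutral_right) (auto simp: finite_Z2n adj_matrix_def)
  also have "\<dots> = \<sigma> x (x + a) * \<sigma> (x + a) ?y + \<sigma> x (x + b) * \<sigma> (x + b) ?y"
  proof -
    \<comment> \<open>The same endpoint in the form that lets \<open>arc\<close> apply to the second
      path.\<close>
    have y: "?y = x + b + a" by (simp add: add_ac)
    have arc: "adj_matrix (QS n S) \<sigma> u (u + s) = \<sigma> u (u + s)" if "u \<in> Z2n n" "s \<in> S" for u s
    proof -
      have "u + s \<in> Z2n n" using that S_subset by (auto intro: Z2n_add)
      then show ?thesis using that by (simp add: adj_matrix_def)
    qed
    show ?thesis
      using ab arc[OF x a] arc[OF x b] arc[OF mem(1) b] arc[OF mem(2) a, folded y] by simp
  qed
  finally show ?thesis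
    using 0 by (simp add: eq_neg_iff_add_eq_0)
qed

lemma gain_swap:
  assumes "x \<in> Z2n n" "a \<in> S" "b \<in> S" "a \<noteq> b"
  shows "gain \<sigma> x (a # b # l) = - gain \<sigma> x (b # a # l)"
  using signing_square[OF assms] by (simp add: mult.assoc[symmetric] add.assoc add.commute[of b])

text \<open>Two equal consecutive labels traverse an edge back and forth, contributing a unit times
  its conjugate.\<close>

lemma gain_cancel:
  assumes "x \<in> Z2n n" "a \<in> S"
  shows "gain \<sigma> x (a # a # l) = gain \<sigma> x l"
proof -
  have "x + a \<in> Z2n n" using assms S_subset by (auto intro: Z2n_add)
  then have "\<sigma> x (x + a) * \<sigma> (x + a) x = 1"
    using assms by (intro signing_mult_cnj) auto
  then show ?thesis
    by (simp add: mult.assoc[symmetric] add.assoc bit_fun_add_self)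
qed

text \<open>Each label of \<open>l\<close> passed costs one sign; \<open>gain_swap\<close> applies
  because \<open>a\<close> differs from all of them.\<close>

lemma gain_move:
  assumes "x \<in> Z2n n" "a \<in> S" "set l \<subseteq> S" "a \<notin> set l"
  shows "gain \<sigma> x (a # l @ m) = (-1) ^ length l * gain \<sigma> x (l @ a # m)"
  using assms
proof (induction l arbitrary: x)
  case (Cons b l)
  then have "x + b \<in> Z2n n" using S_subset by (auto intro: Z2n_add)
  then have IH: "gain \<sigma> (x + b) (a # l @ m) = (-1) ^ length l * gain \<sigma> (x + b) (l @ a # m)"
    using Cons by auto
  have "gain \<sigma> x (a # (b # l) @ m) = - gain \<sigma> x (b # a # l @ m)"
    using gain_swap[of x a b "l @ m"] Cons.prems by auto
  also have "\<dots> = (-1) ^ length (b # l) * gain \<sigma> x ((b # l) @ a # m)"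
    using IH by simp
  finally show ?case .
qed simp

text \<open>Reverse the tail, then move the head behind it. The exponents add up by Pascal's
  rule.\<close>

lemma gain_rev:
  assumes "x \<in> Z2n n" "set l \<subseteq> S" "distinct l"
  shows "gain \<sigma> x (rev l) = (-1) ^ (length l choose 2) * gain \<sigma> x l"
  using assms
proof (induction l arbitrary: x)
  case (Cons a l)
  then have xa: "x + a \<in> Z2n n" using S_subset by (auto intro: Z2n_add)
  have "gain \<sigma> x (a # rev l) = (-1) ^ length l * gain \<sigma> x (rev (a # l))"
    using gain_move[of x a "rev l" "[]"] Cons.prems by simp
  \<comment> \<open>A power of -1 is its own inverse.\<close>
  then have "gain \<sigma> x (rev (a # l)) = (-1) ^ length l * gain \<sigma> x (a # rev l)"
    by (simp add: mult.assoc[symmetric] power_add[symmetric] mult_2[symmetric] del: gain.simps)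
  also have "gain \<sigma> x (a # rev l) = (-1) ^ (length l choose 2) * gain \<sigma> x (a # l)"
  proof -
    have "gain \<sigma> (x + a) (rev l) = (-1) ^ (length l choose 2) * gain \<sigma> (x + a) l"
      using Cons.prems by (intro Cons.IH xa) auto
    then show ?thesis by simp
  qed
  finally show ?case
    by (simp add: power_add numeral_2_eq_2)
qed (simp add: numeral_2_eq_2)

text \<open>From the endpoint, the reversed labels retrace the walk backwards, and each backward arc
  carries the conjugate value.\<close>

lemma gain_rev_cnj:
  assumes "x \<in> Z2n n" "set l \<subseteq> S"
  shows "gain \<sigma> (x + sum_list l) (rev l) = cnj (gain \<sigma> x l)"
  using assms
proof (induction l arbitrary: x)
  case (Cons a l)
  then have xa: "x + a \<in> Z2n n" using S_subset by (auto intro: Z2n_add)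
  have "x + sum_list (a # l) + sum_list l = x + a"
    by (simp add: add.assoc bit_fun_add_self)
  moreover have "sum_list (rev l) = sum_list l" by simp
  ultimately have "gain \<sigma> (x + sum_list (a # l)) (rev (a # l))
      = gain \<sigma> (x + a + sum_list l) (rev l) * \<sigma> (x + a) x"
    by (simp add: gain_append add.assoc bit_fun_add_self)
  also have "\<dots> = cnj (gain \<sigma> (x + a) l) * cnj (\<sigma> x (x + a))"
  proof -
    have "gain \<sigma> (x + a + sum_list l) (rev l) = cnj (gain \<sigma> (x + a) l)"
      using Cons.prems by (intro Cons.IH xa) auto
    then show ?thesis
      using Cons.prems xa signing_cnj[of x "x + a"] by simp
  qed
  finally show ?case by simp
qed simp

lemma gain_mem:
  assumes "x \<in> Z2n n" "set l \<subseteq> S"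
  shows "gain \<sigma> x l \<in> {1, -1, \<i>, -\<i>}"
  using assms
proof (induction l arbitrary: x)
  case (Cons a l)
  then have xa: "x + a \<in> Z2n n" using S_subset by (auto intro: Z2n_add)
  have "gain \<sigma> (x + a) l \<in> {1, -1, \<i>, -\<i>}" using Cons xa by simp
  moreover have "\<sigma> x (x + a) \<in> {1, -1, \<i>, -\<i>}"
    using Cons.prems xa by (intro signing_mem) auto
  ultimately show ?case by auto
qed simp

text \<open>On a closed walk the endpoint is \<open>x\<close> itself, so \<open>gain_rev\<close> and
  \<open>gain_rev_cnj\<close> evaluate the same gain.\<close>

lemma cnj_gain_simple_closed:
  assumes "x \<in> Z2n n" "set l \<subseteq> S" "distinct l" "sum_list l = 0"
  shows "cnj (gain \<sigma> x l) = (-1) ^ (length l choose 2) * gain \<sigma> x l"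
  using gain_rev[OF assms(1-3)] gain_rev_cnj[OF assms(1,2)] assms(4) by simp

text \<open>Reduce the tail first; a new head is kept if fresh, and otherwise moved next to its
  other occurrence and cancelled. One \<open>m\<close> serves all starts because the induction
  passes from \<open>x\<close> to \<open>x + a\<close>.\<close>

lemma gain_reduce:
  assumes "set l \<subseteq> S"
  shows "\<exists>m. set m \<subseteq> S \<and> distinct m \<and> sum_list m = sum_list l \<and>
    (\<forall>x\<in>Z2n n. gain \<sigma> x l \<in> {gain \<sigma> x m, - gain \<sigma> x m})"
  using assms
proof (induction l)
  case Nil
  show ?case by (rule exI[of _ "[]"]) simp
next
  case (Cons a l)
  then obtain m where m: "set m \<subseteq> S" "distinct m" "sum_list m = sum_list l"
    "\<And>x. x \<in> Z2n n \<Longrightarrow> gain \<sigma> x l \<in> {gain \<sigma> x m, - gain \<sigma> x m}"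
    by auto
  have a: "a \<in> S" using Cons.prems by simp
  have step: "gain \<sigma> x (a # l) \<in> {gain \<sigma> x (a # m), - gain \<sigma> x (a # m)}" if "x \<in> Z2n n" for x
  proof -
    have "x + a \<in> Z2n n" using that a S_subset by (auto intro: Z2n_add)
    then show ?thesis using m(4)[of "x + a"] by auto
  qed
  show ?case
  proof (cases "a \<in> set m")
    case False
    then show ?thesis using m a step by (intro exI[of _ "a # m"]) auto
  next
    case True
    then obtain p q where pq: "m = p @ a # q" by (meson split_list)
    \<comment> \<open>Distinctness of \<open>m\<close> keeps \<open>a\<close> out of
      \<open>p\<close>, so \<open>a\<close> can be moved past \<open>p\<close> by
      \<open>gain_move\<close>.\<close>
    have ap: "a \<notin> set p" "set p \<subseteq> S" using m pq by auto
    have "gain \<sigma> x (a # l) \<in> {gain \<sigma> x (p @ q), - gain \<sigma> x (p @ q)}" if x: "x \<in> Z2n n" for x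
    proof -
      have "x + sum_list p \<in> Z2n n"
        using x ap S_subset by (intro Z2n_add_sum_list) auto
      then have "gain \<sigma> x (p @ a # a # q) = gain \<sigma> x (p @ q)"
        using a by (simp add: gain_append gain_cancel del: gain.simps)
      then have "gain \<sigma> x (a # m) = (-1) ^ length p * gain \<sigma> x (p @ q)"
        using gain_move[OF x a ap(2,1), of "a # q"] by (simp add: pq del: gain.simps)
      then show ?thesis
        using step[OF x] by (cases "even (length p)") (auto simp del: gain.simps)
    qed
    moreover have "sum_list (p @ q) = sum_list (a # l)"
      using m(3)[symmetric] by (simp add: pq add.left_commute[of a])
    ultimately show ?thesis
      using m(1,2) pq by (intro exI[of _ "p @ q"] conjI ballI) auto
  qed
qed

text \<open>Conjugating \<open>M\<close> by a diagonal matrix of fourth roots of unity preserves \<open>M\<^sup>2 = d I\<close>.\<close>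

lemma unitary_signing_switch:
  assumes f: "\<And>x. x \<in> Z2n n \<Longrightarrow> f x \<in> {1, -1, \<i>, -\<i>}"
  shows "unitary_signing (QS n S) (\<lambda>x y. f x * \<sigma> x y * cnj (f y))"
proof -
  let ?\<tau> = "\<lambda>x y. f x * \<sigma> x y * cnj (f y)"
  let ?A = "adj_matrix (QS n S)"
  obtain d where d: "regular_graph (QS n S) d"
    "\<And>x y. x \<in> Z2n n \<Longrightarrow> y \<in> Z2n n \<Longrightarrow>
      (\<Sum>z\<in>Z2n n. ?A \<sigma> x z * ?A \<sigma> z y) = (if x = y then of_nat d else 0)"
    using unitary unfolding unitary_signing_def by auto
  have unit: "cnj (f x) * f x = 1" if "x \<in> Z2n n" for x
    using f[OF that] by auto
  have "complex_signing (QS n S) ?\<tau>"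
    unfolding complex_signing_def
  proof clarify
    fix x y assume "(x, y) \<in> parcs (QS n S)"
    then have xy: "x \<in> Z2n n" "y \<in> Z2n n" "x + y \<in> S" by auto
    show "?\<tau> x y \<in> {1, -1, \<i>, -\<i>} \<and> ?\<tau> y x = cnj (?\<tau> x y)"
      using f[OF xy(1)] f[OF xy(2)] signing_mem[OF xy] signing_cnj[OF xy] by auto
  qed
  moreover have "(\<Sum>z\<in>Z2n n. ?A ?\<tau> x z * ?A ?\<tau> z y) = (if x = y then of_nat d else 0)"
    if "x \<in> Z2n n" "y \<in> Z2n n" for x y
  proof -
    have "?A ?\<tau> x z * ?A ?\<tau> z y = f x * (?A \<sigma> x z * ?A \<sigma> z y) * cnj (f y)" if "z \<in> Z2n n" for z
    proof -
      \<comment> \<open>The factors of \<open>f\<close> at the middle vertex \<open>z\<close>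
        combine to 1.\<close>
      have "?A ?\<tau> x z * ?A ?\<tau> z y
          = f x * (?A \<sigma> x z * ?A \<sigma> z y) * cnj (f y) * (cnj (f z) * f z)"
        by (simp add: adj_matrix_def algebra_simps)
      then show ?thesis by (simp only: unit[OF that] mult_1_right)
    qed
    then have "(\<Sum>z\<in>Z2n n. ?A ?\<tau> x z * ?A ?\<tau> z y)
        = f x * (\<Sum>z\<in>Z2n n. ?A \<sigma> x z * ?A \<sigma> z y) * cnj (f y)"
      by (simp add: sum_distrib_left sum_distrib_right)
    then show ?thesis
      using d(2)[OF that] unit[OF that(1)] by (auto simp: mult.commute mult.left_commute)
  qed
  ultimately show ?thesis
    using d(1) unfolding unitary_signing_def by auto
qed

end

text \<open>Raising \<open>k\<close> by 4 adds the even number \<open>4 * k + 6\<close> to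
  \<open>k choose 2\<close>, so the parity depends only on the residue modulo 4.\<close>

lemma even_choose_2_iff: "even (k choose 2) \<longleftrightarrow> k mod 4 \<notin> {2, 3}"
proof -
  have "even ((4 * q + r) choose 2) \<longleftrightarrow> even (r choose 2)" for q r :: nat
  proof (induction q)
    case (Suc q)
    have "(m + 4) choose 2 = (m choose 2) + 4 * m + 6" for m
      by (simp add: numeral_eq_Suc)
    from this[of "4 * q + r"] have "4 * Suc q + r choose 2 = (4 * q + r choose 2) + 4 * (4 * q + r) + 6"
      by (simp add: algebra_simps)
    then show ?case using Suc by simp
  qed simp
  from this[of "k div 4" "k mod 4"] have "even (k choose 2) \<longleftrightarrow> even (k mod 4 choose 2)"
    by simp
  moreover have "k mod 4 \<in> {0, 1, 2, 3}" by auto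
  ultimately show ?thesis
    by (elim insertE emptyE) (simp_all add: choose_two)
qed

theorem theorem4p12:
  fixes n :: nat and S :: "(nat \<Rightarrow> bit) set"
  assumes "S \<subseteq> Z2n n"
    and "sidon S"
    and "0 \<notin> S"
    and "group_closure S = Z2n n"
    and "\<exists>\<sigma>. unitary_signing (QS n S) \<sigma>"
  shows "(\<exists>\<sigma>. orthogonal_signing (QS n S) \<sigma>) \<longleftrightarrow>
    \<not> (\<exists>p. S_simple_closed_walk n S p \<and> length p mod 4 \<in> {2, 3})"
  unfolding S_simple_closed_walk_iff[OF assms(1,3), where P = "\<lambda>k. k mod 4 \<in> {2, 3}"]
proof
  assume "\<exists>\<sigma>. orthogonal_signing (QS n S) \<sigma>"
  then obtain \<tau> where \<tau>: "unitary_signing (QS n S) \<tau>"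
    "\<forall>(x, y)\<in>parcs (QS n S). \<tau> x y \<in> {1, -1}"
    by (auto simp: orthogonal_signing_def)
  interpret unitary_QS n S \<tau>
    using assms \<tau> by unfold_locales
  have gain_real: "gain \<tau> x l \<in> {1, -1}" if "x \<in> Z2n n" "set l \<subseteq> S" for x l
    using that
  proof (induction l arbitrary: x)
    case (Cons a l)
    then have xa: "x + a \<in> Z2n n" using assms(1) by (auto intro: Z2n_add)
    have "gain \<tau> (x + a) l \<in> {1, -1}" using Cons xa by simp
    moreover have "\<tau> x (x + a) \<in> {1, -1}"
      using Cons.prems xa \<tau>(2) by auto
    ultimately show ?case by auto
  qed simp
  show "\<not> (\<exists>l. set l \<subseteq> S \<and> distinct l \<and> sum_list l = 0 \<and> length l mod 4 \<in> {2, 3})"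
  proof clarify
    fix l assume l: "set l \<subseteq> S" "distinct l" "sum_list l = 0" "length l mod 4 \<in> {2, 3}"
    \<comment> \<open>An odd exponent would make conjugation negate the gain, but conjugation fixes
      1 and -1.\<close>
    have "odd (length l choose 2)" using l(4) by (simp add: even_choose_2_iff)
    then show False
      using cnj_gain_simple_closed[OF Z2n_0 l(1-3)] gain_real[OF Z2n_0 l(1)] by auto
  qed
next
  assume no_walk: "\<not> (\<exists>l. set l \<subseteq> S \<and> distinct l \<and> sum_list l = 0 \<and> length l mod 4 \<in> {2, 3})"
  obtain \<sigma> where "unitary_signing (QS n S) \<sigma>" using assms(5) by blast
  then interpret unitary_QS n S \<sigma>
    using assms by unfold_locales
  have gain_closed: "gain \<sigma> 0 l \<in> {1, -1}" if l: "set l \<subseteq> S" "sum_list l = 0" for l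
  proof -
    obtain m where m: "set m \<subseteq> S" "distinct m" "sum_list m = 0"
      "gain \<sigma> 0 l \<in> {gain \<sigma> 0 m, - gain \<sigma> 0 m}"
      using gain_reduce[OF l(1)] l(2) Z2n_0 by auto
    then have "even (length m choose 2)"
      using no_walk unfolding even_choose_2_iff by blast
    then have "cnj (gain \<sigma> 0 m) = gain \<sigma> 0 m"
      using cnj_gain_simple_closed[OF Z2n_0 m(1-3)] by simp
    \<comment> \<open>Among the fourth roots of unity, only 1 and -1 are real.\<close>
    then have "gain \<sigma> 0 m \<in> {1, -1}"
      using gain_mem[OF Z2n_0 m(1)] by auto
    with m(4) show ?thesis by auto
  qed
  have "\<forall>x\<in>Z2n n. \<exists>l. set l \<subseteq> S \<and> sum_list l = x"
    using group_closure_sum_list assms(4) by blast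
  from bchoice[OF this] obtain L
    where L: "\<And>x. x \<in> Z2n n \<Longrightarrow> set (L x) \<subseteq> S \<and> sum_list (L x) = x"
    by blast
  \<comment> \<open>The lists \<open>L x\<close> fix a walk from 0 to each vertex; its gain is the
    switching factor there.\<close>
  define f where "f x = gain \<sigma> 0 (L x)" for x
  have "f x * \<sigma> x y * cnj (f y) \<in> {1, -1}" if "x \<in> Z2n n" "y \<in> Z2n n" "x + y \<in> S" for x y
  proof -
    have "cnj (f y) = gain \<sigma> y (rev (L y))"
      using gain_rev_cnj[OF Z2n_0, of "L y"] L[OF that(2)] by (simp add: f_def)
    \<comment> \<open>The switched value on an arc is the gain of a closed walk at 0: out along
      \<open>L x\<close>, across the arc, and back along \<open>L y\<close> reversed.\<close>
    then have "f x * \<sigma> x y * cnj (f y) = gain \<sigma> 0 (L x @ (x + y) # rev (L y))"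
      using L[OF that(1)] by (simp add: f_def gain_append)
    moreover have "sum_list (L x @ (x + y) # rev (L y)) = 0"
      using L[OF that(1)] L[OF that(2)] by (simp add: add.assoc bit_fun_add_self)
    ultimately show ?thesis
      using gain_closed[of "L x @ (x + y) # rev (L y)"] L[OF that(1)] L[OF that(2)] that(3) by auto
  qed
  moreover have "unitary_signing (QS n S) (\<lambda>x y. f x * \<sigma> x y * cnj (f y))"
    using L gain_mem[OF Z2n_0] by (intro unitary_signing_switch) (auto simp: f_def)
  ultimately have "orthogonal_signing (QS n S) (\<lambda>x y. f x * \<sigma> x y * cnj (f y))"
    unfolding orthogonal_signing_def by (metis (no_types, lifting) case_prodI2 parcs_QS_iff)
  then show "\<exists>\<sigma>. orthogonal_signing (QS n S) \<sigma>" by blast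
qed

end
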